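(* There exists a nonempty family $\mathcal{F}$ of triangulations of subsets of $\mathbb{R}^2$ that is $\left(\frac{\pi}{6},2\right)$-nondegenerate, extendable, and subdividable; that is, a nonempty family $\mathcal{F}$ such that: (1) all angles of all triangles in all $\mathcal{T}\in\mathcal{F}$ are $\geq \frac{\pi}{6}$; (2) for every $\mathcal{T}\in\mathcal{F}$, all ratios of edge lengths of $\mathcal{T}$ are bounded from above by $2$; (3) for every $\mathcal{T}\in\mathcal{F}$ there is a $\mathcal{T}_{\mathrm{ext}}\in\mathcal{F}$ such that $\mathcal{T}_{\mathrm{ext}}$ triangulates $\mathbb{R}^2$ and $\mathcal{T}\subset\mathcal{T}_{\mathrm{ext}}$; (4) given any $\varepsilon>0$ and any $\mathcal{T}\in\mathcal{F}$, there is a subdivision $\tilde{\mathcal{T}}$ of $\mathcal{T}$ such that $\tilde{\mathcal{T}}\in\mathcal{F}$ and all edges of $\tilde{\mathcal{T}}$ have length $<\varepsilon$.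
   Context: Triangulations are geometric simplicial complexes in $\mathbb{R}^2$ with straight edges. For $\theta_0,\sigma_0>0$, a family of triangulations of subsets of $\mathbb{R}^2$ is called $(\theta_0,\sigma_0)$-nondegenerate, extendable, and subdividable if it satisfies (1)-(4) with $\theta_0$ in place of $\pi/6$ and $\sigma_0$ in place of $2$. *)

theory Defs
  imports "HOL-Analysis.Analysis"
begin

(* The library's simplicial_complex with finiteness weakened to local finiteness on the
   underlying space, so that all of the plane can be triangulated. Some such condition is
   needed: otherwise the set of all singletons would triangulate the plane. As in the library,
   the empty set is a simplex (of dimension -1) and belongs to every nonempty complex. *)
definition geometric_complex :: "'a::euclidean_space set set \<Rightarrow> bool" where
  "geometric_complex \<T> \<longleftrightarrow>
     locally_finite_in (top_of_set (\<Union>\<T>)) \<T> \<and>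
     (\<forall>S\<in>\<T>. \<exists>n. n simplex S) \<and>
     (\<forall>F S. S \<in> \<T> \<and> F face_of S \<longrightarrow> F \<in> \<T>) \<and>
     (\<forall>S S'. S \<in> \<T> \<and> S' \<in> \<T> \<longrightarrow> (S \<inter> S') face_of S)"

lemma finite_geometric_complex_iff:
  "finite \<T> \<Longrightarrow> geometric_complex \<T> \<longleftrightarrow> simplicial_complex \<T>"
  by (auto simp: geometric_complex_def simplicial_complex_def finite_imp_locally_finite_in)

definition triangulates :: "'a::euclidean_space set set \<Rightarrow> 'a set \<Rightarrow> bool" where
  "triangulates \<T> X \<longleftrightarrow> geometric_complex \<T> \<and> \<Union>\<T> = X"

definition edge_lengths :: "'a::euclidean_space set set \<Rightarrow> real set" where
  "edge_lengths \<T> = {dist a b | a b. a \<noteq> b \<and> closed_segment a b \<in> \<T>}"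

(* the angle at the vertex b, in [0, pi], for a and c different from b *)
definition angle_at :: "'a::real_inner \<Rightarrow> 'a \<Rightarrow> 'a \<Rightarrow> real" where
  "angle_at a b c = arccos (((a - b) \<bullet> (c - b)) / (norm (a - b) * norm (c - b)))"

(* If convex hull {a, b, c} is a 2-simplex, then a, b, c are its three (distinct) vertices. *)
definition triangle_angles :: "'a::euclidean_space set set \<Rightarrow> real set" where
  "triangle_angles \<T> =
     {angle_at a b c | a b c. 2 simplex (convex hull {a, b, c}) \<and> convex hull {a, b, c} \<in> \<T>}"

definition subdivision_of ::
    "'a::euclidean_space set set \<Rightarrow> 'a set set \<Rightarrow> bool" (infix \<open>subdivision'_of\<close> 50) where
  "\<T>' subdivision_of \<T> \<longleftrightarrow>
     geometric_complex \<T>' \<and>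
     (\<forall>S'\<in>\<T>'. \<exists>S\<in>\<T>. S' \<subseteq> S) \<and>
     (\<forall>S\<in>\<T>. \<exists>\<A>\<subseteq>\<T>'. finite \<A> \<and> S = \<Union>\<A>)"

lemma subdivision_of_Union: "\<T>' subdivision_of \<T> \<Longrightarrow> \<Union>\<T>' = \<Union>\<T>"
  unfolding subdivision_of_def by blast

definition nondegenerate :: "real \<Rightarrow> real \<Rightarrow> (real ^ 2) set set set \<Rightarrow> bool" where
  "nondegenerate \<theta> \<sigma> \<F> \<longleftrightarrow>
     (\<forall>\<T>\<in>\<F>. \<forall>\<alpha>\<in>triangle_angles \<T>. \<theta> \<le> \<alpha>) \<and>
     (\<forall>\<T>\<in>\<F>. \<forall>l\<in>edge_lengths \<T>. \<forall>m\<in>edge_lengths \<T>. l / m \<le> \<sigma>)"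

definition extendable :: "(real ^ 2) set set set \<Rightarrow> bool" where
  "extendable \<F> \<longleftrightarrow>
     (\<forall>\<T>\<in>\<F>. \<exists>\<T>\<^sub>e\<in>\<F>. triangulates \<T>\<^sub>e UNIV \<and> \<T> \<subseteq> \<T>\<^sub>e)"

definition subdividable :: "(real ^ 2) set set set \<Rightarrow> bool" where
  "subdividable \<F> \<longleftrightarrow>
     (\<forall>\<epsilon>>0. \<forall>\<T>\<in>\<F>. \<exists>\<T>'\<in>\<F>. \<T>' subdivision_of \<T> \<and> (\<forall>l\<in>edge_lengths \<T>'. l < \<epsilon>))"

end

theory Submission
  imports Defs
begin

text \<open>For the three families of lines on which \<open>N x\<close>, \<open>N y\<close> or \<open>N (x - y)\<close> is an integer, the
  cells of the arrangement form a triangulation \<open>\<T>\<^sub>N\<close> of the plane by isosceles right triangles with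
  legs of length \<open>1 / N\<close>; its angles are \<open>\<pi>/4\<close> and \<open>\<pi>/2\<close>, and its edge lengths \<open>1 / N\<close> and
  \<open>\<surd>2 / N\<close>. The lines for \<open>N\<close> are among those for \<open>N M\<close>, so \<open>\<T>\<^bsub>N M\<^esub>\<close> subdivides \<open>\<T>\<^sub>N\<close>; take the
  family of all \<open>\<T>\<^sub>N\<close> with \<open>N \<ge> 1\<close>.\<close>

section \<open>Cells of an arrangement of integer hyperplanes\<close>

text \<open>The smallest closed cell containing \<open>p\<close> of the arrangement of the hyperplanes \<open>N (a \<bullet> x) = k\<close>,
  where \<open>a \<in> A\<close> and \<open>k\<close> is an integer.\<close>

definition cell :: "'a::euclidean_space set \<Rightarrow> nat \<Rightarrow> 'a \<Rightarrow> 'a set" where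
  "cell A N p = {x. \<forall>a\<in>A. \<lfloor>N * (a \<bullet> p)\<rfloor> \<le> N * (a \<bullet> x) \<and> N * (a \<bullet> x) \<le> \<lceil>N * (a \<bullet> p)\<rceil>}"

definition cells :: "'a::euclidean_space set \<Rightarrow> nat \<Rightarrow> 'a set set" where
  "cells A N = insert {} (range (cell A N))"

lemma cell_self [simp]: "p \<in> cell A N p"
  by (auto simp: cell_def)

text \<open>The bounds defining \<open>cell A N p\<close> are integers, so rounding
  \<open>N * (a \<bullet> q)\<close> down or up cannot cross them.\<close>

lemma cell_mono:
  assumes "q \<in> cell A N p"
  shows "cell A N q \<subseteq> cell A N p"
proof
  fix x assume x: "x \<in> cell A N q"
  have "\<lfloor>N * (a \<bullet> p)\<rfloor> \<le> N * (a \<bullet> x) \<and> N * (a \<bullet> x) \<le> \<lceil>N * (a \<bullet> p)\<rceil>" if "a \<in> A" for a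
  proof -
    have "\<lfloor>N * (a \<bullet> p)\<rfloor> \<le> \<lfloor>N * (a \<bullet> q)\<rfloor>" "\<lceil>N * (a \<bullet> q)\<rceil> \<le> \<lceil>N * (a \<bullet> p)\<rceil>"
      using assms that by (auto simp: cell_def le_floor_iff ceiling_le_iff)
    moreover have "\<lfloor>N * (a \<bullet> q)\<rfloor> \<le> N * (a \<bullet> x)" "N * (a \<bullet> x) \<le> \<lceil>N * (a \<bullet> q)\<rceil>"
      using x that by (auto simp: cell_def)
    ultimately show ?thesis
      by linarith
  qed
  then show "x \<in> cell A N p"
    by (simp add: cell_def)
qed

section \<open>Convexity and faces of cells\<close>

lemma convex_cell: "convex (cell A N p)"
proof -
  have "cell A N p = (\<Inter>a\<in>A. {x. (N *\<^sub>R a) \<bullet> x \<ge> \<lfloor>N * (a \<bullet> p)\<rfloor>} \<inter> {x. (N *\<^sub>R a) \<bullet> x \<le> \<lceil>N * (a \<bullet> p)\<rceil>})"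
    by (auto simp: cell_def)
  then show ?thesis
    by (simp only:) (intro convex_INT convex_Int convex_halfspace_ge convex_halfspace_le)
qed

text \<open>One-dimensional core of the face property. The intervals from floor to ceiling of
  \<open>s\<close> and of \<open>t\<close> are integer points or unit intervals, so the second
  contains the first or meets it at most in an endpoint, and an endpoint is extreme.\<close>

lemma integer_interval_face:
  fixes X Y u s t :: real
  assumes X: "\<lfloor>s\<rfloor> \<le> X" "X \<le> \<lceil>s\<rceil>" and Y: "\<lfloor>s\<rfloor> \<le> Y" "Y \<le> \<lceil>s\<rceil>"
    and u: "0 < u" "u < 1"
    and Z: "\<lfloor>t\<rfloor> \<le> (1 - u) * X + u * Y" "(1 - u) * X + u * Y \<le> \<lceil>t\<rceil>"
  shows "\<lfloor>t\<rfloor> \<le> X \<and> X \<le> \<lceil>t\<rceil>"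
proof -
  have le: "\<lceil>s\<rceil> \<le> \<lfloor>s\<rfloor> + 1"
    by linarith
  have XY: "(1 - u) * (X - c) + u * (Y - c) = (1 - u) * X + u * Y - c" for c
    by (simp add: algebra_simps)
  consider "\<lfloor>t\<rfloor> \<le> \<lfloor>s\<rfloor>" "\<lceil>s\<rceil> \<le> \<lceil>t\<rceil>" | "\<lceil>t\<rceil> \<le> \<lfloor>s\<rfloor>" | "\<lceil>s\<rceil> \<le> \<lfloor>t\<rfloor>"
    using le by linarith
  then show ?thesis
  proof cases
    case 1
    then show ?thesis using X by linarith
  next
    case 2
    have "0 \<le> (1 - u) * (X - \<lfloor>s\<rfloor>)" "0 \<le> u * (Y - \<lfloor>s\<rfloor>)"
      using X Y u by auto
    moreover have "(1 - u) * (X - \<lfloor>s\<rfloor>) + u * (Y - \<lfloor>s\<rfloor>) \<le> 0"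
      using XY[of "\<lfloor>s\<rfloor>"] Z 2 by linarith
    ultimately have "(1 - u) * (X - \<lfloor>s\<rfloor>) = 0" and "u * (Y - \<lfloor>s\<rfloor>) = 0"
      by linarith+
    then have "X = \<lfloor>s\<rfloor>" "Y = \<lfloor>s\<rfloor>"
      using u by auto
    then show ?thesis
      using Z by (simp add: algebra_simps)
  next
    case 3
    have "0 \<le> (1 - u) * (\<lceil>s\<rceil> - X)" "0 \<le> u * (\<lceil>s\<rceil> - Y)"
      using X Y u by auto
    moreover have "(1 - u) * (\<lceil>s\<rceil> - X) + u * (\<lceil>s\<rceil> - Y) \<le> 0"
      using XY[of "\<lceil>s\<rceil>"] Z 3 by (simp add: algebra_simps)
    ultimately have "(1 - u) * (\<lceil>s\<rceil> - X) = 0" and "u * (\<lceil>s\<rceil> - Y) = 0"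
      by linarith+
    then have "X = \<lceil>s\<rceil>" "Y = \<lceil>s\<rceil>"
      using u by auto
    then show ?thesis
      using Z by (simp add: algebra_simps)
  qed
qed

text \<open>Each functional \<open>N * (a \<bullet> x)\<close> is linear along a segment, which
  reduces the claim to \<open>integer_interval_face\<close>, one normal at a time.\<close>

lemma cell_Int_face: "cell A N p \<inter> cell A N q face_of cell A N p"
proof -
  \<comment> \<open>Only the endpoint \<open>x\<close> is treated; commuting the open segment gives
    the other one.\<close>
  have *: "x \<in> cell A N q"
    if x: "x \<in> cell A N p" and y: "y \<in> cell A N p" and z: "z \<in> cell A N q"
      and xyz: "z \<in> open_segment x y" for x y z
  proof -
    obtain u where u: "0 < u" "u < 1" "z = (1 - u) *\<^sub>R x + u *\<^sub>R y"
      using xyz by (auto simp: in_segment)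
    show ?thesis
      unfolding cell_def
    proof clarify
      fix a assume a: "a \<in> A"
      have "N * (a \<bullet> z) = (1 - u) * (N * (a \<bullet> x)) + u * (N * (a \<bullet> y))"
        by (simp add: u(3) inner_right_distrib algebra_simps)
      then have z: "\<lfloor>N * (a \<bullet> q)\<rfloor> \<le> (1 - u) * (N * (a \<bullet> x)) + u * (N * (a \<bullet> y))"
        "(1 - u) * (N * (a \<bullet> x)) + u * (N * (a \<bullet> y)) \<le> \<lceil>N * (a \<bullet> q)\<rceil>"
        using a z by (auto simp: cell_def)
      have xy: "\<lfloor>N * (a \<bullet> p)\<rfloor> \<le> N * (a \<bullet> x)" "N * (a \<bullet> x) \<le> \<lceil>N * (a \<bullet> p)\<rceil>"
        "\<lfloor>N * (a \<bullet> p)\<rfloor> \<le> N * (a \<bullet> y)" "N * (a \<bullet> y) \<le> \<lceil>N * (a \<bullet> p)\<rceil>"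
        using a x y by (auto simp: cell_def)
      show "\<lfloor>N * (a \<bullet> q)\<rfloor> \<le> N * (a \<bullet> x) \<and> N * (a \<bullet> x) \<le> \<lceil>N * (a \<bullet> q)\<rceil>"
        by (rule integer_interval_face[OF xy u(1,2) z])
    qed
  qed
  show ?thesis
    unfolding face_of_def
    by (auto simp: convex_Int convex_cell intro: * simp: open_segment_commute)
qed

lemma cell_face_of_cell: "q \<in> cell A N p \<Longrightarrow> cell A N q face_of cell A N p"
  using cell_Int_face[of A N p q] cell_mono[of q A N p] by (simp add: Int_absorb1)

text \<open>Expresses that \<open>q\<close> is relatively interior to its own cell. Where
  \<open>N * (a \<bullet> q)\<close> is an integer, the functional is constant on the cell;
  elsewhere both bounds are strict at \<open>q\<close> and survive a small step beyond it.
  Finiteness of \<open>A\<close> yields one step for all normals.\<close>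

lemma extend_segment_in_cell:
  assumes "finite A" "x \<in> cell A N q" "x \<noteq> q"
  shows "\<exists>y\<in>cell A N q. q \<in> open_segment x y"
proof -
  define y where "y d = q + d *\<^sub>R (q - x)" for d :: real
  have Ny: "N * (a \<bullet> y d) = N * (a \<bullet> q) + d * (N * (a \<bullet> q) - N * (a \<bullet> x))" for a d
    by (simp add: y_def inner_right_distrib inner_diff_right algebra_simps)
  have "\<forall>\<^sub>F d in at_right 0. \<lfloor>N * (a \<bullet> q)\<rfloor> \<le> N * (a \<bullet> y d) \<and> N * (a \<bullet> y d) \<le> \<lceil>N * (a \<bullet> q)\<rceil>"
    if a: "a \<in> A" for a
  proof (cases "N * (a \<bullet> q) \<in> \<int>")
    case True
    then obtain k where k: "N * (a \<bullet> q) = of_int k"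
      by (auto elim: Ints_cases)
    have "N * (a \<bullet> x) = of_int k"
      using assms a by (auto simp: cell_def k dest!: bspec)
    then show ?thesis
      by (simp add: Ny k)
  next
    case False
    have "(N * (a \<bullet> q)) \<noteq> \<lfloor>N * (a \<bullet> q)\<rfloor>" "(N * (a \<bullet> q)) \<noteq> \<lceil>N * (a \<bullet> q)\<rceil>"
      using False by (metis Ints_of_int)+
    then have lt: "\<lfloor>N * (a \<bullet> q)\<rfloor> < N * (a \<bullet> q)" "N * (a \<bullet> q) < \<lceil>N * (a \<bullet> q)\<rceil>"
      by linarith+
    have "((\<lambda>d. N * (a \<bullet> y d)) \<longlongrightarrow> N * (a \<bullet> q) + 0 * (N * (a \<bullet> q) - N * (a \<bullet> x))) (at_right 0)"
      unfolding Ny by (intro tendsto_intros)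
    then have "((\<lambda>d. N * (a \<bullet> y d)) \<longlongrightarrow> N * (a \<bullet> q)) (at_right 0)"
      by simp
    from order_tendstoD(1)[OF this lt(1)] order_tendstoD(2)[OF this lt(2)]
    show ?thesis
      by eventually_elim simp
  qed
  then have "\<forall>\<^sub>F d in at_right 0. y d \<in> cell A N q"
    using assms by (simp add: cell_def eventually_ball_finite_distrib)
  then have "\<forall>\<^sub>F d in at_right 0. y d \<in> cell A N q \<and> d > (0::real)"
    by (simp add: eventually_conj eventually_at_right_less)
  then obtain d :: real where d: "y d \<in> cell A N q" "d > 0"
    using eventually_happens'[OF trivial_limit_at_right_real] by blast
  \<comment> \<open>The vector from \<open>x\<close> to \<open>y d\<close> is \<open>1 + d\<close>
    times the one from \<open>x\<close> to \<open>q\<close>, hence the weight.\<close>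
  have "q = (1 - 1 / (1 + d)) *\<^sub>R x + (1 / (1 + d)) *\<^sub>R y d"
  proof -
    have "1 - 1 / (1 + d) = d / (1 + d)"
      using d(2) by (simp add: field_simps)
    then have "(1 - 1 / (1 + d)) *\<^sub>R x + (1 / (1 + d)) *\<^sub>R y d = (1 / (1 + d)) *\<^sub>R (d *\<^sub>R x + y d)"
      by (simp add: scaleR_add_right)
    also have "d *\<^sub>R x + y d = (1 + d) *\<^sub>R q"
      by (simp add: y_def algebra_simps)
    finally show ?thesis
      using d(2) by simp
  qed
  moreover have "x \<noteq> y d"
  proof
    assume "x = y d"
    then have "(1 + d) *\<^sub>R (q - x) = 0"
      by (simp add: y_def algebra_simps)
    then show False using assms d(2) by auto
  qed
  ultimately have "q \<in> open_segment x (y d)"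
    using d(2) unfolding in_segment by (intro conjI exI[of _ "1 / (1 + d)"]) auto
  then show ?thesis
    using d(1) by blast
qed

text \<open>A nonempty face \<open>F\<close> is the cell of any of its relatively interior points
  \<open>q\<close>: that cell is itself a face and meets the relative interior of \<open>F\<close>,
  so it contains \<open>F\<close>; conversely, segments through \<open>q\<close> inside the cell
  have their endpoints in the face \<open>F\<close>.\<close>

lemma face_of_cell_in_cells:
  assumes "finite A" "F face_of cell A N p"
  shows "F \<in> cells A N"
proof (cases "F = {}")
  case False
  then obtain q where q: "q \<in> rel_interior F"
    using assms(2) face_of_imp_convex rel_interior_eq_empty by blast
  have qF: "q \<in> F"
    using q rel_interior_subset by blast
  have Fp: "F \<subseteq> cell A N p"
    using assms(2) face_of_imp_subset by blast
  have qp: "cell A N q face_of cell A N p"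
    using qF Fp by (blast intro: cell_face_of_cell)
  have "F \<subseteq> cell A N q"
    by (rule subset_of_face_of[OF qp Fp]) (use q cell_self in blast)
  moreover have "cell A N q \<subseteq> F"
  proof
    fix x assume x: "x \<in> cell A N q"
    show "x \<in> F"
    proof (cases "x = q")
      case False
      then obtain y where "y \<in> cell A N q" "q \<in> open_segment x y"
        using extend_segment_in_cell assms(1) x by blast
      then show ?thesis
        using assms(2) qF x face_of_imp_subset[OF qp] unfolding face_of_def by blast
    qed (use qF in simp)
  qed
  ultimately show ?thesis
    by (auto simp: cells_def)
qed (simp add: cells_def)

section \<open>Local finiteness and the complex of all cells\<close>

text \<open>A cell is determined by one pair of integers per normal, and a point of \<open>B\<close>
  in the cell confines these pairs to a finite range.\<close>

lemma finite_cells_meeting_bounded: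
  assumes "finite A" "bounded B"
  shows "finite {C \<in> cells A N. C \<inter> B \<noteq> {}}"
proof -
  have "\<exists>K::int. \<forall>x\<in>B. \<bar>N * (a \<bullet> x)\<bar> \<le> K" for a
  proof -
    obtain r where r: "\<And>x. x \<in> B \<Longrightarrow> norm x \<le> r"
      using assms(2) by (auto simp: bounded_iff)
    have "\<bar>N * (a \<bullet> x)\<bar> \<le> \<lceil>N * (norm a * r)\<rceil>" if "x \<in> B" for x
    proof -
      have "\<bar>a \<bullet> x\<bar> \<le> norm a * r"
        using Cauchy_Schwarz_ineq2[of a x] r[OF that] mult_left_mono[of "norm x" r "norm a"] by force
      then have "\<bar>N * (a \<bullet> x)\<bar> \<le> N * (norm a * r)"
        by (simp add: abs_mult mult_left_mono)
      then show ?thesis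
        by linarith
    qed
    then show ?thesis by blast
  qed
  then obtain K :: "'a \<Rightarrow> int" where K: "\<And>a x. x \<in> B \<Longrightarrow> \<bar>N * (a \<bullet> x)\<bar> \<le> K a"
    by metis
  \<comment> \<open>The point of \<open>B\<close> need not be \<open>p\<close>: its value lies
    between floor and ceiling, which differ by at most 1, hence the extra unit on the outer
    sides.\<close>
  define G where "G = Pi\<^sub>E A (\<lambda>a. {-K a-1..K a} \<times> {-K a..K a+1})"
  define g where "g f = {x. \<forall>a\<in>A. of_int (fst (f a)) \<le> N * (a \<bullet> x) \<and> N * (a \<bullet> x) \<le> of_int (snd (f a))}"
    for f :: "'a \<Rightarrow> int \<times> int"
  have "{C \<in> cells A N. C \<inter> B \<noteq> {}} \<subseteq> g ` G"
  proof
    fix C assume "C \<in> {C \<in> cells A N. C \<inter> B \<noteq> {}}"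
    then obtain p x where C: "C = cell A N p" and x: "x \<in> cell A N p" "x \<in> B"
      by (auto simp: cells_def)
    define f where "f = restrict (\<lambda>a. (\<lfloor>N * (a \<bullet> p)\<rfloor>, \<lceil>N * (a \<bullet> p)\<rceil>)) A"
    have "C = g f"
      by (auto simp: C g_def f_def cell_def)
    moreover have "f \<in> G"
      unfolding G_def
    proof (rule PiE_I)
      fix a assume a: "a \<in> A"
      have "\<lfloor>N * (a \<bullet> p)\<rfloor> \<le> N * (a \<bullet> x)" "N * (a \<bullet> x) \<le> \<lceil>N * (a \<bullet> p)\<rceil>"
        using x(1) a by (auto simp: cell_def)
      with K[OF x(2), of a] show "f a \<in> {-K a-1..K a} \<times> {-K a..K a+1}"
        using a by (simp add: f_def) linarith
    qed (auto simp: f_def)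
    ultimately show "C \<in> g ` G"
      by blast
  qed
  moreover have "finite G"
    unfolding G_def using assms(1) by (intro finite_PiE) auto
  ultimately show ?thesis
    by (meson finite_imageI finite_subset)
qed

lemma Union_cells [simp]: "\<Union>(cells A N) = UNIV"
  by (auto simp: cells_def intro: cell_self)

text \<open>Every finite arrangement satisfies the remaining conditions, so the choice of normals
  only has to make the cells simplices.\<close>

lemma geometric_complex_cells:
  assumes "finite A" and simp: "\<And>p. \<exists>n. n simplex cell A N p"
  shows "geometric_complex (cells A N)"
  unfolding geometric_complex_def
proof (intro conjI allI ballI impI)
  show "locally_finite_in (top_of_set (\<Union>(cells A N))) (cells A N)"
    unfolding locally_finite_in_def
  proof (intro conjI ballI)
    fix x :: 'a
    show "\<exists>V. openin (top_of_set (\<Union>(cells A N))) V \<and> x \<in> V \<and> finite {U \<in> cells A N. U \<inter> V \<noteq> {}}"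
      by (intro exI[of _ "ball x 1"] conjI finite_cells_meeting_bounded assms) auto
  qed auto
next
  fix S assume "S \<in> cells A N"
  then show "\<exists>n. n simplex S"
    using simp by (auto simp: cells_def)
next
  fix F S assume "S \<in> cells A N \<and> F face_of S"
  then show "F \<in> cells A N"
    using face_of_cell_in_cells[OF assms(1)] by (auto simp: cells_def)
next
  fix S S' assume "S \<in> cells A N \<and> S' \<in> cells A N"
  then show "S \<inter> S' face_of S"
    by (auto simp: cells_def cell_Int_face)
qed

section \<open>Passing to a finer arrangement\<close>

text \<open>The bounds of the coarse cell, multiplied by \<open>M\<close>, are still integers, so
  the floor and ceiling at level \<open>N * M\<close> respect them.\<close>

lemma cell_refine:
  assumes "M > 0"
  shows "cell A (N * M) p \<subseteq> cell A N p"
proof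
  fix x assume x: "x \<in> cell A (N * M) p"
  have "\<lfloor>N * (a \<bullet> p)\<rfloor> \<le> N * (a \<bullet> x) \<and> N * (a \<bullet> x) \<le> \<lceil>N * (a \<bullet> p)\<rceil>" if a: "a \<in> A" for a
  proof -
    have "M * \<lfloor>N * (a \<bullet> p)\<rfloor> \<le> M * (N * (a \<bullet> p))" "M * (N * (a \<bullet> p)) \<le> M * \<lceil>N * (a \<bullet> p)\<rceil>"
      by (simp_all add: mult_left_mono)
    then have "int M * \<lfloor>N * (a \<bullet> p)\<rfloor> \<le> \<lfloor>(N * M) * (a \<bullet> p)\<rfloor>" "\<lceil>(N * M) * (a \<bullet> p)\<rceil> \<le> int M * \<lceil>N * (a \<bullet> p)\<rceil>"
      by (auto simp: le_floor_iff ceiling_le_iff mult_ac)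
    then have "of_int (int M * \<lfloor>N * (a \<bullet> p)\<rfloor>) \<le> (N * M) * (a \<bullet> x)"
      "(N * M) * (a \<bullet> x) \<le> of_int (int M * \<lceil>N * (a \<bullet> p)\<rceil>)"
      using x a unfolding cell_def mem_Collect_eq by (meson of_int_le_iff order_trans)+
    then have "M * \<lfloor>N * (a \<bullet> p)\<rfloor> \<le> M * (N * (a \<bullet> x))" "M * (N * (a \<bullet> x)) \<le> M * \<lceil>N * (a \<bullet> p)\<rceil>"
      by (simp_all add: mult_ac)
    then show ?thesis
      using assms by simp
  qed
  then show "x \<in> cell A N p"
    by (simp add: cell_def)
qed

text \<open>A coarse cell is the union of the fine cells of its points. All of these meet a bounded
  set, so there are finitely many.\<close>

lemma subdivision_of_cells:
  assumes "finite A" "M > 0" and "geometric_complex (cells A (N * M))"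
    and bounded: "\<And>p. bounded (cell A N p)"
  shows "cells A (N * M) subdivision_of cells A N"
  unfolding subdivision_of_def
proof (intro conjI ballI)
  fix S' assume "S' \<in> cells A (N * M)"
  then show "\<exists>S\<in>cells A N. S' \<subseteq> S"
    using cell_refine[OF assms(2)] unfolding cells_def by blast
next
  fix S assume "S \<in> cells A N"
  then consider "S = {}" | p where "S = cell A N p"
    by (auto simp: cells_def)
  then show "\<exists>\<A>\<subseteq>cells A (N * M). finite \<A> \<and> S = \<Union>\<A>"
  proof cases
    case 1
    then show ?thesis by blast
  next
    case 2
    let ?\<A> = "cell A (N * M) ` S"
    have "?\<A> \<subseteq> {C \<in> cells A (N * M). C \<inter> S \<noteq> {}}"
      by (auto simp: cells_def intro: cell_self)
    then have "finite ?\<A>"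
      using finite_cells_meeting_bounded[OF assms(1)] bounded 2 finite_subset by blast
    moreover have "cell A (N * M) q \<subseteq> S" if "q \<in> S" for q
      using cell_refine[OF assms(2), of A N q] cell_mono[of q A N p] that 2 by blast
    then have "S = \<Union>?\<A>"
      by (auto intro: cell_self)
    ultimately show ?thesis
      by (intro exI[of _ ?\<A>]) (auto simp: cells_def)
  qed
qed (fact assms)

section \<open>Isosceles right triangles\<close>

locale isosceles_right_triangle =
  fixes P Q R :: "'a::euclidean_space" and h :: real
  assumes legs: "norm (Q - P) = h" "norm (R - Q) = h"
    and right_angle: "(Q - P) \<bullet> (R - Q) = 0"
    and h_pos: "h > 0"
begin

lemma inner_legs:
  "(Q - P) \<bullet> (Q - P) = h\<^sup>2" "(R - Q) \<bullet> (R - Q) = h\<^sup>2" "(R - P) \<bullet> (R - P) = 2 * h\<^sup>2"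
  "(Q - P) \<bullet> (R - P) = h\<^sup>2" "(R - Q) \<bullet> (R - P) = h\<^sup>2"
proof -
  show *: "(Q - P) \<bullet> (Q - P) = h\<^sup>2" "(R - Q) \<bullet> (R - Q) = h\<^sup>2"
    using legs by (auto simp: power2_norm_eq_inner[symmetric])
  have "R - P = (Q - P) + (R - Q)"
    by simp
  then show "(R - P) \<bullet> (R - P) = 2 * h\<^sup>2" "(Q - P) \<bullet> (R - P) = h\<^sup>2" "(R - Q) \<bullet> (R - P) = h\<^sup>2"
    using * right_angle by (simp_all only: inner_add_left inner_add_right inner_commute[of "R - Q" "Q - P"])
qed

lemma hypotenuse: "norm (R - P) = sqrt 2 * h"
  using h_pos by (simp add: norm_eq_sqrt_inner inner_legs real_sqrt_mult)

lemma distinct_vertices: "P \<noteq> Q" "Q \<noteq> R" "P \<noteq> R"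
  using h_pos legs hypotenuse by auto

text \<open>Collinearity would make \<open>R - Q\<close> a multiple of \<open>P - Q\<close>, to
  which it is orthogonal, forcing \<open>h = 0\<close>.\<close>

lemma affine_independent: "\<not> affine_dependent {P, Q, R}"
proof
  assume "affine_dependent {P, Q, R}"
  then have "collinear {0, P - Q, R - Q}"
    using affine_dependent_imp_collinear_3[of P Q R] collinear_3[of P Q R] by simp
  then obtain c where c: "R - Q = c *\<^sub>R (P - Q)"
    using distinct_vertices by (auto simp: collinear_lemma)
  have "(R - Q) \<bullet> (R - Q) = - c * ((Q - P) \<bullet> (R - Q))"
    by (subst (1) c) (simp add: inner_diff_left algebra_simps)
  then show False
    using right_angle h_pos inner_legs by simp
qed

lemma face_simplex:
  assumes "F face_of convex hull {P, Q, R}"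
  shows "\<exists>n. n simplex F"
proof -
  obtain C where C: "C \<subseteq> {P, Q, R}" "F = convex hull C"
    using assms face_of_convex_hull_affine_independent[OF affine_independent] by blast
  then show ?thesis
    using affine_independent affine_independent_subset
    \<comment> \<open>For the empty face this is dimension -1.\<close>
    by (intro exI[of _ "int (card C) - 1"]) (auto simp: simplex_def)
qed

text \<open>Recovers the vertices of an edge or triangle that is known only as a set: extreme points
  of a face are extreme in the whole hull.\<close>

lemma extreme_point_of_face_vertex:
  assumes "F face_of convex hull {P, Q, R}" "x extreme_point_of F"
  shows "x \<in> {P, Q, R}"
  using assms extreme_point_of_convex_hull extreme_point_of_face by blast

lemma edge_length:
  assumes "closed_segment a b face_of convex hull {P, Q, R}" "a \<noteq> b"
  shows "dist a b \<in> {h, sqrt 2 * h}"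
proof -
  have "a \<in> {P, Q, R}" "b \<in> {P, Q, R}"
    using extreme_point_of_face_vertex[OF assms(1)] by (simp_all add: extreme_point_of_segment)
  then show ?thesis
    using assms(2) legs hypotenuse by (auto simp: dist_norm norm_minus_commute)
qed

text \<open>The points \<open>a\<close>, \<open>b\<close>, \<open>c\<close> are a permutation of
  \<open>P\<close>, \<open>Q\<close>, \<open>R\<close>, so the cosine at \<open>b\<close> is 0 or
  \<open>sqrt 2 / 2\<close>, and \<open>arccos\<close> is decreasing.\<close>

lemma angle:
  assumes "convex hull {a, b, c} face_of convex hull {P, Q, R}" "2 simplex convex hull {a, b, c}"
  shows "pi / 4 \<le> angle_at a b c"
proof -
  have "\<not> collinear {a, b, c}"
    using aff_dim_simplex[OF assms(2)] by (simp add: collinear_aff_dim aff_dim_convex_hull)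
  then have abc: "a \<noteq> b" "a \<noteq> c" "b \<noteq> c" "\<not> affine_dependent {a, b, c}"
    by (auto simp: collinear_3_eq_affine_dependent)
  then have "a \<in> {P, Q, R}" "b \<in> {P, Q, R}" "c \<in> {P, Q, R}"
    using extreme_point_of_face_vertex[OF assms(1)]
    by (simp_all add: extreme_point_of_convex_hull_affine_independent)
  moreover have "(P - Q) \<bullet> (R - Q) = 0" "(P - R) \<bullet> (Q - R) = h\<^sup>2"
    using right_angle inner_legs by (simp_all add: inner_diff_left inner_diff_right inner_commute)
  moreover have "h\<^sup>2 = sqrt 2 / 2 * (h * (sqrt 2 * h))"
    by (simp add: power2_eq_square)
  moreover note inner_legs(4) legs hypotenuse
  ultimately have "(a - b) \<bullet> (c - b) \<le> sqrt 2 / 2 * (norm (a - b) * norm (c - b))"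
    using abc h_pos by (auto simp: norm_minus_commute inner_commute mult.commute)
  moreover have pos: "norm (a - b) * norm (c - b) > 0"
    using abc by simp
  ultimately have "(a - b) \<bullet> (c - b) / (norm (a - b) * norm (c - b)) \<le> sqrt 2 / 2"
    by (simp add: divide_le_eq)
  moreover have "- 1 \<le> (a - b) \<bullet> (c - b) / (norm (a - b) * norm (c - b))"
    using Cauchy_Schwarz_ineq2[of "a - b" "c - b"] pos by (simp add: le_divide_eq)
  ultimately have "arccos (sqrt 2 / 2) \<le> angle_at a b c"
    \<comment> \<open>The instance says that \<open>sqrt 2\<close> is at most 2, which keeps
      \<open>sqrt 2 / 2\<close> in the domain of \<open>arccos\<close>.\<close>
    unfolding angle_at_def using real_sqrt_le_mono[of 2 4] by (intro arccos_le_arccos) auto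
  then show ?thesis
    using arccos_cos[of "pi / 4"] pi_gt_zero by (simp add: cos_45)
qed

end

section \<open>The triangulation of the plane\<close>

text \<open>The cells for these normals form the Freudenthal (Kuhn) triangulation: cubes cut
  according to the order of the fractional parts of the coordinates.\<close>

definition normals :: "(real ^ 'n) set" where
  "normals = range (\<lambda>i. axis i 1) \<union> range (\<lambda>(i, j). axis i 1 - axis j 1)"

lemma finite_normals [simp]: "finite (normals :: (real ^ 'n) set)"
  by (simp add: normals_def)

lemma cell_normals_iff:
  "x \<in> cell normals N p \<longleftrightarrow>
     (\<forall>i. \<lfloor>N * p $ i\<rfloor> \<le> N * x $ i \<and> N * x $ i \<le> \<lceil>N * p $ i\<rceil>) \<and>
     (\<forall>i j. \<lfloor>N * (p $ i - p $ j)\<rfloor> \<le> N * (x $ i - x $ j) \<and> N * (x $ i - x $ j) \<le> \<lceil>N * (p $ i - p $ j)\<rceil>)"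
  unfolding cell_def normals_def
  by (auto simp: ball_Un inner_axis' inner_diff_left)

text \<open>The triangle is the cell of its centroid \<open>r\<close>; the coordinate of \<open>N p\<close> with the larger
  fractional part is called \<open>i\<close>.\<close>

lemma cell_in_triangle:
  fixes p :: "real ^ 2"
  assumes "N > 0"
  shows "\<exists>P Q R. isosceles_right_triangle P Q R (1 / N) \<and> cell normals N p face_of convex hull {P, Q, R}"
proof -
  obtain i j :: 2 where ij: "i \<noteq> j" and frac: "frac (N * p $ j) \<le> frac (N * p $ i)"
    by (metis linorder_le_cases one_neq_zero)
  have UNIV: "k = i \<or> k = j" for k
    using ij by (metis exhaust_2)
  have all2: "(\<forall>k. A k) \<longleftrightarrow> A i \<and> A j" for A :: "2 \<Rightarrow> bool"
    using UNIV by metis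
  define m n where "m = \<lfloor>N * p $ i\<rfloor>" and "n = \<lfloor>N * p $ j\<rfloor>"
  define vec2 :: "real \<Rightarrow> real \<Rightarrow> real ^ 2" where "vec2 s t = (1 / N) *\<^sub>R (\<chi> k. if k = i then s else t)" for s t
  have vec2 [simp]: "N * vec2 s t $ i = s" "N * vec2 s t $ j = t" for s t
    using assms ij by (auto simp: vec2_def)
  have vec2_diff: "vec2 s t - vec2 s' t' = vec2 (s - s') (t - t')" for s t s' t'
    by (auto simp: vec2_def vec_eq_iff diff_divide_distrib)
  have inner_vec2: "vec2 s t \<bullet> vec2 s' t' = (s * s' + t * t') / N\<^sup>2" for s t s' t'
  proof -
    have U: "(UNIV :: 2 set) = {i, j}"
      using UNIV by auto
    have "sum f UNIV = f i + f j" for f :: "2 \<Rightarrow> real"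
      unfolding U using ij by simp
    then show ?thesis
      using ij by (simp add: inner_vec_def vec2_def power2_eq_square add_divide_distrib mult.commute)
  qed
  \<comment> \<open>In the coordinates \<open>i\<close>, \<open>j\<close>, this is the half of the
    grid square around \<open>p\<close> where the fractional part in direction \<open>i\<close>
    dominates.\<close>
  define P Q R r where "P = vec2 m n" and "Q = vec2 (m + 1) n" and "R = vec2 (m + 1) (n + 1)"
    and "r = vec2 (m + 2 / 3) (n + 1 / 3)"
  interpret isosceles_right_triangle P Q R "1 / N"
    by unfold_locales
      (use assms in \<open>simp_all add: P_def Q_def R_def vec2_diff norm_eq_sqrt_inner inner_vec2 real_sqrt_divide\<close>)
  \<comment> \<open>These inequalities are the three sides of the triangle; together they imply the
    other bounds of the cell.\<close>
  have cell_r: "x \<in> cell normals N r \<longleftrightarrow>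
      n \<le> N * x $ j \<and> N * x $ j - n \<le> N * x $ i - m \<and> N * x $ i \<le> m + 1" for x
  proof -
    have fl: "\<lfloor>m + 2/3 :: real\<rfloor> = m" "\<lceil>m + 2/3 :: real\<rceil> = m + 1" "\<lfloor>n + 1/3 :: real\<rfloor> = n" "\<lceil>n + 1/3 :: real\<rceil> = n + 1"
      "\<lfloor>m + 2/3 - (n + 1/3) :: real\<rfloor> = m - n" "\<lceil>m + 2/3 - (n + 1/3) :: real\<rceil> = m - n + 1"
      "\<lfloor>n + 1/3 - (m + 2/3) :: real\<rfloor> = n - m - 1" "\<lceil>n + 1/3 - (m + 2/3) :: real\<rceil> = n - m"
      by linarith+
    show ?thesis
      unfolding cell_normals_iff all2 r_def right_diff_distrib vec2 fl by auto
  qed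
  have "cell normals N r = convex hull {P, Q, R}"
  proof (intro equalityI subsetI)
    fix x assume "x \<in> cell normals N r"
    then have x: "n \<le> N * x $ j" "N * x $ j - n \<le> N * x $ i - m" "N * x $ i \<le> m + 1"
      by (auto simp: cell_r)
    \<comment> \<open>Barycentric coordinates of \<open>x\<close> at \<open>R\<close> and
      \<open>Q\<close>; the three sides say that they and \<open>1 - v - w\<close> are
      nonnegative.\<close>
    define w v where "w = N * x $ j - n" and "v = N * x $ i - m - w"
    have "x = (1 - v - w) *\<^sub>R P + v *\<^sub>R Q + w *\<^sub>R R"
    proof -
      have "x $ k = ((1 - v - w) *\<^sub>R P + v *\<^sub>R Q + w *\<^sub>R R) $ k" for k
        using UNIV[of k] ij assms
        by (auto simp: P_def Q_def R_def vec2_def v_def w_def field_simps)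
      then show ?thesis
        by (simp add: vec_eq_iff)
    qed
    then show "x \<in> convex hull {P, Q, R}"
      unfolding convex_hull_3 mem_Collect_eq
      by (intro exI[of _ "1 - v - w"] exI[of _ v] exI[of _ w]) (use x in \<open>auto simp: v_def w_def\<close>)
  next
    fix x assume "x \<in> convex hull {P, Q, R}"
    moreover have "{P, Q, R} \<subseteq> cell normals N r"
      by (auto simp: cell_r P_def Q_def R_def)
    ultimately show "x \<in> cell normals N r"
      using hull_minimal[of _ _ convex] convex_cell by blast
  qed
  \<comment> \<open>The chosen order of the fractional parts is the middle inequality of
    \<open>cell_r\<close>.\<close>
  moreover have "p \<in> cell normals N r"
    unfolding cell_r using frac by (simp add: frac_def m_def n_def)
  ultimately show ?thesis
    using cell_face_of_cell isosceles_right_triangle_axioms by metis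
qed

section \<open>Angles, edge lengths and subdivisions of the plane complexes\<close>

definition plane_complex :: "nat \<Rightarrow> (real ^ 2) set set" where
  "plane_complex N = cells normals N"

text \<open>Reduces metric questions about a simplex to a single right triangle; for the empty
  simplex any triangle will do.\<close>

lemma plane_complex_face_of_triangle:
  assumes "N > 0" "S \<in> plane_complex N"
  obtains P Q R where "isosceles_right_triangle P Q R (1 / N)" "S face_of convex hull {P, Q, R}"
proof -
  have "S = {} \<or> (\<exists>p. S = cell normals N p)"
    using assms(2) by (auto simp: plane_complex_def cells_def)
  then show ?thesis
    using cell_in_triangle[OF assms(1)] that by (metis empty_face_of)
qed

lemma geometric_complex_plane_complex:
  assumes "N > 0"
  shows "geometric_complex (plane_complex N)"
  unfolding plane_complex_def
proof (rule geometric_complex_cells)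
  show "\<exists>n. n simplex cell normals N p" for p :: "real ^ 2"
    using cell_in_triangle[OF assms, of p] isosceles_right_triangle.face_simplex by blast
qed simp

lemma edge_lengths_plane_complex:
  assumes "N > 0" "l \<in> edge_lengths (plane_complex N)"
  shows "l \<in> {1 / N, sqrt 2 * (1 / N)}"
proof -
  obtain a b where ab: "l = dist a b" "a \<noteq> b" "closed_segment a b \<in> plane_complex N"
    using assms(2) unfolding edge_lengths_def by blast
  obtain P Q R where "isosceles_right_triangle P Q R (1 / N)" "closed_segment a b face_of convex hull {P, Q, R}"
    using plane_complex_face_of_triangle[OF assms(1) ab(3)] .
  then show ?thesis
    unfolding ab(1) using ab(2) by (rule isosceles_right_triangle.edge_length)
qed

lemma triangle_angles_plane_complex:
  assumes "N > 0" "\<alpha> \<in> triangle_angles (plane_complex N)"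
  shows "pi / 4 \<le> \<alpha>"
proof -
  obtain a b c where abc: "\<alpha> = angle_at a b c" "2 simplex convex hull {a, b, c}"
      "convex hull {a, b, c} \<in> plane_complex N"
    using assms(2) unfolding triangle_angles_def by blast
  obtain P Q R where "isosceles_right_triangle P Q R (1 / N)" "convex hull {a, b, c} face_of convex hull {P, Q, R}"
    using plane_complex_face_of_triangle[OF assms(1) abc(3)] .
  then show ?thesis
    unfolding abc(1) using abc(2) by (rule isosceles_right_triangle.angle)
qed

lemma plane_complex_subdivision:
  assumes "N > 0" "M > 0"
  shows "plane_complex (N * M) subdivision_of plane_complex N"
  unfolding plane_complex_def
proof (rule subdivision_of_cells)
  show "geometric_complex (cells normals (N * M) :: (real ^ 2) set set)"
    using geometric_complex_plane_complex[of "N * M"] assms by (simp add: plane_complex_def)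
  fix p :: "real ^ 2"
  obtain P Q R where "cell normals N p face_of convex hull {P, Q, R}"
    using cell_in_triangle[OF assms(1)] by blast
  then show "bounded (cell normals N p)"
    by (meson bounded_convex_hull bounded_subset face_of_imp_subset finite.emptyI finite.insertI finite_imp_bounded)
qed (use assms in auto)

theorem theorem3:
  shows "\<exists>\<F> :: (real ^ 2) set set set.
           \<F> \<noteq> {} \<and>
           (\<forall>\<T>\<in>\<F>. geometric_complex \<T>) \<and>
           nondegenerate (pi / 6) 2 \<F> \<and>
           extendable \<F> \<and>
           subdividable \<F>"
proof (intro exI conjI)
  \<comment> \<open>The value 0 is excluded because its only nonempty cell is the whole
    plane.\<close>
  let ?\<F> = "plane_complex ` {0<..}"
  have sqrt2: "1 \<le> sqrt 2" "sqrt 2 \<le> 2"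
    using real_sqrt_le_mono[of 2 4] by auto
  show "?\<F> \<noteq> {}"
    by auto
  show gc: "\<forall>\<T>\<in>?\<F>. geometric_complex \<T>"
    by (auto intro: geometric_complex_plane_complex)
  show "nondegenerate (pi / 6) 2 ?\<F>"
    unfolding nondegenerate_def
  proof (intro conjI ballI)
    fix \<T> \<alpha> assume "\<T> \<in> ?\<F>" "\<alpha> \<in> triangle_angles \<T>"
    then have "pi / 4 \<le> \<alpha>"
      using triangle_angles_plane_complex by blast
    then show "pi / 6 \<le> \<alpha>"
      using pi_gt_zero by linarith
  next
    fix \<T> l l' assume "\<T> \<in> ?\<F>" "l \<in> edge_lengths \<T>" "l' \<in> edge_lengths \<T>"
    then obtain N where "N > 0" "l \<in> edge_lengths (plane_complex N)" "l' \<in> edge_lengths (plane_complex N)"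
      by auto
    then have "l \<in> {1 / N, sqrt 2 * (1 / N)}" "l' \<in> {1 / N, sqrt 2 * (1 / N)}"
      using edge_lengths_plane_complex by blast+
    moreover have "0 < 1 / N" "1 / N \<le> sqrt 2 * (1 / N)" "sqrt 2 * (1 / N) \<le> 2 * (1 / N)"
      using \<open>N > 0\<close> mult_right_mono[OF sqrt2(1), of "1 / N"] mult_right_mono[OF sqrt2(2), of "1 / N"] by auto
    ultimately have "l \<le> 2 * (1 / N)" "1 / N \<le> l'"
      by (elim insertE emptyE; linarith)+
    with \<open>0 < 1 / N\<close> have "0 < l'" "l \<le> 2 * l'"
      by linarith+
    then show "l / l' \<le> 2"
      by (simp add: divide_le_eq)
  qed
  \<comment> \<open>Every member already triangulates the plane and serves as its own
    extension.\<close>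
  show "extendable ?\<F>"
    using gc unfolding extendable_def triangulates_def by (fastforce simp: plane_complex_def)
  show "subdividable ?\<F>"
    unfolding subdividable_def
  proof (intro allI impI ballI)
    fix \<epsilon> :: real and \<T> assume "\<epsilon> > 0" "\<T> \<in> ?\<F>"
    then obtain N where N: "N > 0" "\<T> = plane_complex N"
      by auto
    \<comment> \<open>Edges at level \<open>N * M\<close> have length at most
      \<open>2 / (N * M)\<close>, which is at most \<open>2 / M\<close> because \<open>N\<close> is
      at least 1.\<close>
    obtain M :: nat where M: "2 / \<epsilon> < M"
      using reals_Archimedean2 by blast
    with \<open>\<epsilon> > 0\<close> have "M > 0"
      by (metis divide_pos_pos of_nat_0_less_iff order_less_trans zero_less_numeral)
    have "2 * (1 / real (N * M)) < \<epsilon>"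
    proof -
      have "2 < \<epsilon> * M"
        using M \<open>\<epsilon> > 0\<close> by (simp add: divide_less_eq mult.commute)
      also have "\<dots> \<le> \<epsilon> * (N * M)"
        using N \<open>\<epsilon> > 0\<close> by (intro mult_left_mono of_nat_mono) auto
      finally show ?thesis
        using N \<open>M > 0\<close> by (simp add: divide_less_eq mult_ac)
    qed
    moreover have "l \<le> 2 * (1 / real (N * M))" if "l \<in> edge_lengths (plane_complex (N * M))" for l
    proof -
      have "l \<in> {1 / real (N * M), sqrt 2 * (1 / real (N * M))}"
        using edge_lengths_plane_complex[OF _ that] N \<open>M > 0\<close> by simp
      moreover have "0 \<le> 1 / real (N * M)" "sqrt 2 * (1 / real (N * M)) \<le> 2 * (1 / real (N * M))"
        using sqrt2 by (auto intro: mult_right_mono simp del: times_divide_eq_right)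
      ultimately show ?thesis
        by (elim insertE emptyE; linarith)
    qed
    ultimately show "\<exists>\<T>'\<in>?\<F>. \<T>' subdivision_of \<T> \<and> (\<forall>l\<in>edge_lengths \<T>'. l < \<epsilon>)"
      using plane_complex_subdivision N \<open>M > 0\<close>
      by (intro bexI[of _ "plane_complex (N * M)"]) (auto intro: order_le_less_trans)
  qed
qed

end
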